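(* Let $Q(t)\in\mathbb{H}[t]\setminus\mathbb{C}[t]$ be a monic polynomial of degree $n\ge 1$, written as $Q(t)=f(t)+\mathbf{k}\,g(t)$ with $f(t),g(t)\in\mathbb{C}[t]$, and write $f=f_1+f_2\mathbf{i}$, $g=g_1+g_2\mathbf{i}$ with $f_1,f_2,g_1,g_2\in\mathbb{R}[t]$. Put $E(t)=\gcd(f(t),g(t))\in\mathbb{C}[t]$ and $D(t)=\gcd(f_1(t),f_2(t),g_1(t),g_2(t))\in\mathbb{R}[t]$. Then the only monic right factor of $Q(t)$ lying in $\mathbb{C}[t]$ and having the highest degree (among right factors of $Q(t)$ lying in $\mathbb{C}[t]$) is $E(t)$, and its degree is $n-\operatorname{rank}\operatorname{Bez}(f,g)$. Furthermore, if $z\in\mathbb{R}$, then $z$ is a root of $Q(t)$ if and only if $z$ is a root of $D(t)$.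
   Context: $\mathbb{H}$ is the skew field of real quaternions $x_0+x_1\mathbf{i}+x_2\mathbf{j}+x_3\mathbf{k}$, and $\mathbb{C}=\mathbb{R}+\mathbb{R}\mathbf{i}\subset\mathbb{H}$. In $\mathbb{H}[t]$ the variable $t$ commutes with the coefficients; for $P(t)=a_0t^n+a_1t^{n-1}+\cdots+a_n$ and $q\in\mathbb{H}$ the evaluation is $P(q)=a_0q^n+a_1q^{n-1}+\cdots+a_n$, and $q$ is a root of $P$ if $P(q)=0$. Every $Q\in\mathbb{H}[t]$ is uniquely $f+\mathbf{k}g$ with $f,g\in\mathbb{C}[t]$; for $Q$ monic of degree $n\ge1$ and not in $\mathbb{C}[t]$, $f$ and $g$ are nonzero, $\deg f_1=\deg f=n$, and $f_2,g_1,g_2$ have degree less than $n$. A polynomial $B(t)\in\mathbb{H}[t]$ is a right factor of $Q(t)$ if there is $C(t)\in\mathbb{H}[t]$ with $Q(t)=C(t)B(t)$. Greatest common divisors are taken monic. Bézout matrix: for a field $F$ of characteristic zero and $P,R\in F[x]$ with $d=\max\{\deg P,\deg R\}$, write $\frac{P(x)R(y)-P(y)R(x)}{x-y}=\sum_{i,j=0}^{d-1}c_{i,j}x^iy^j$; then $\operatorname{Bez}(P,R)$ is the $d\times d$ matrix $(c_{i,j})_{0\le i,j\le d-1}$. *)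

theory Defs
  imports
    Complex_Main
    "HOL-Computational_Algebra.Computational_Algebra"
    "HOL-Computational_Algebra.Field_as_Ring"
    "Jordan_Normal_Form.DL_Rank"
begin

section \<open>Quaternions\<close>

datatype quat = Quat (qRe: real) (qI: real) (qJ: real) (qK: real)

lemma quat_eq_iff: "x = y \<longleftrightarrow> qRe x = qRe y \<and> qI x = qI y \<and> qJ x = qJ y \<and> qK x = qK y"
  by (metis quat.expand)

instantiation quat :: ab_group_add
begin

definition "0 = Quat 0 0 0 0"
definition "x + y = Quat (qRe x + qRe y) (qI x + qI y) (qJ x + qJ y) (qK x + qK y)"
definition "x - y = Quat (qRe x - qRe y) (qI x - qI y) (qJ x - qJ y) (qK x - qK y)"
definition "- x = Quat (- qRe x) (- qI x) (- qJ x) (- qK x)"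

instance
  by standard
    (simp_all add: quat_eq_iff zero_quat_def plus_quat_def minus_quat_def uminus_quat_def)

end

instantiation quat :: real_algebra_1
begin

definition "1 = Quat 1 0 0 0"
definition "scaleR r x = Quat (r * qRe x) (r * qI x) (r * qJ x) (r * qK x)"
definition "x * y = Quat
  (qRe x * qRe y - qI x * qI y - qJ x * qJ y - qK x * qK y)
  (qRe x * qI y + qI x * qRe y + qJ x * qK y - qK x * qJ y)
  (qRe x * qJ y - qI x * qK y + qJ x * qRe y + qK x * qI y)
  (qRe x * qK y + qI x * qJ y - qJ x * qI y + qK x * qRe y)"

instance
  by standard
    (simp_all add: quat_eq_iff zero_quat_def plus_quat_def one_quat_def scaleR_quat_def
      times_quat_def algebra_simps)

end

instantiation quat :: real_div_algebra
begin

definition "inverse x = scaleR (inverse ((qRe x)\<^sup>2 + (qI x)\<^sup>2 + (qJ x)\<^sup>2 + (qK x)\<^sup>2))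
  (Quat (qRe x) (- qI x) (- qJ x) (- qK x))"
definition "x div y = x * inverse (y :: quat)"

instance
proof
  fix x :: quat
  assume "x \<noteq> 0"
  let ?N = "(qRe x)\<^sup>2 + (qI x)\<^sup>2 + (qJ x)\<^sup>2 + (qK x)\<^sup>2"
  have "?N \<noteq> 0"
    using \<open>x \<noteq> 0\<close>
    by (auto simp: quat_eq_iff zero_quat_def add_nonneg_eq_0_iff)
  then have N: "inverse ?N * ?N = 1" by simp
  have *: "x * Quat (qRe x) (- qI x) (- qJ x) (- qK x) = scaleR ?N 1"
    "Quat (qRe x) (- qI x) (- qJ x) (- qK x) * x = scaleR ?N 1"
    by (simp_all add: quat_eq_iff times_quat_def scaleR_quat_def one_quat_def power2_eq_square
        algebra_simps)
  show "inverse x * x = 1" "x * inverse x = 1"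
    by (simp_all only: inverse_quat_def mult_scaleR_left mult_scaleR_right * scaleR_scaleR N
        scaleR_one)
next
  show "inverse (0 :: quat) = 0"
    by (simp add: inverse_quat_def quat_eq_iff zero_quat_def scaleR_quat_def)
qed (rule divide_quat_def)

end

definition quat_i :: quat where "quat_i = Quat 0 1 0 0"
definition quat_j :: quat where "quat_j = Quat 0 0 1 0"
definition quat_k :: quat where "quat_k = Quat 0 0 0 1"

lemma quat_unit_products:
  "quat_i * quat_i = - 1" "quat_j * quat_j = - 1" "quat_k * quat_k = - 1"
  "quat_i * quat_j = quat_k" "quat_j * quat_k = quat_i" "quat_k * quat_i = quat_j"
  "quat_j * quat_i = - quat_k" "quat_k * quat_j = - quat_i" "quat_i * quat_k = - quat_j"
  by (simp_all add: quat_i_def quat_j_def quat_k_def times_quat_def one_quat_def uminus_quat_def)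

definition quat_of_complex :: "complex \<Rightarrow> quat" where
  "quat_of_complex z = of_real (Re z) + of_real (Im z) * quat_i"

lemma of_real_quat: "of_real r = Quat r 0 0 0"
  by (simp add: of_real_def scaleR_quat_def one_quat_def)

lemma quat_of_complex_eq: "quat_of_complex z = Quat (Re z) (Im z) 0 0"
  by (simp add: quat_of_complex_def of_real_quat quat_i_def times_quat_def plus_quat_def)

lemma quat_of_complex_hom [simp]:
  "quat_of_complex 0 = 0" "quat_of_complex 1 = 1"
  "quat_of_complex (z + w) = quat_of_complex z + quat_of_complex w"
  "quat_of_complex (z * w) = quat_of_complex z * quat_of_complex w"
  by (simp_all add: quat_of_complex_eq zero_quat_def one_quat_def plus_quat_def times_quat_def)

lemma quat_of_complex_of_real [simp]: "quat_of_complex (of_real r) = of_real r"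
  by (simp add: quat_of_complex_eq of_real_quat)

lemma inj_quat_of_complex: "inj quat_of_complex"
  by (rule injI) (simp add: quat_of_complex_eq complex_eq_iff)


section \<open>Polynomials over a not necessarily commutative ring\<close>

text \<open>
  The library's product and \<^const>\<open>poly\<close> on \<^typ>\<open>'a poly\<close> require commutative coefficients.
  Here the variable commutes with the coefficients, and evaluation puts the coefficients to the
  left of the powers of the argument; evaluation is therefore not multiplicative in general.
\<close>

definition nc_times :: "'a::semiring_0 poly \<Rightarrow> 'a poly \<Rightarrow> 'a poly" (infixl \<open>\<star>\<close> 70) where
  "P \<star> R = (\<Sum>i\<le>degree P. \<Sum>j\<le>degree R. monom (coeff P i * coeff R j) (i + j))"

definition nc_eval :: "'a::semiring_1 poly \<Rightarrow> 'a \<Rightarrow> 'a" where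
  "nc_eval P q = (\<Sum>i\<le>degree P. coeff P i * q ^ i)"

lemma coeff_nc_times: "coeff (P \<star> R) m = (\<Sum>i\<le>m. coeff P i * coeff R (m - i))"
proof -
  have inner: "(\<Sum>j\<le>degree R. coeff (monom (coeff P i * coeff R j) (i + j)) m) =
      (if i \<le> m then coeff P i * coeff R (m - i) else 0)" for i
  proof (cases "i \<le> m")
    case True
    then have "(\<Sum>j\<le>degree R. coeff (monom (coeff P i * coeff R j) (i + j)) m) =
        (\<Sum>j\<le>degree R. if j = m - i then coeff P i * coeff R j else 0)"
      by (intro sum.cong) auto
    also have "\<dots> = coeff P i * coeff R (m - i)"
      by (simp add: sum.delta coeff_eq_0)
    finally show ?thesis using True by simp
  qed (auto intro!: sum.neutral)
  have "coeff (P \<star> R) m = (\<Sum>i\<le>degree P. if i \<le> m then coeff P i * coeff R (m - i) else 0)"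
    by (simp only: nc_times_def coeff_sum inner)
  also have "\<dots> = (\<Sum>i\<in>{..degree P} \<inter> {..m}. coeff P i * coeff R (m - i))"
    by (simp only: sum.inter_restrict[OF finite_atMost] atMost_iff)
  also have "\<dots> = (\<Sum>i\<le>m. coeff P i * coeff R (m - i))"
    by (intro sum.mono_neutral_left) (auto intro: ccontr simp: coeff_eq_0 not_le)
  finally show ?thesis .
qed

lemma nc_times_eq_times: "P \<star> R = P * (R :: 'a::comm_semiring_0 poly)"
  by (simp add: poly_eq_iff coeff_nc_times coeff_mult)

lemma nc_eval_eq_poly: "nc_eval P q = poly P (q :: 'a::comm_semiring_1)"
  by (simp add: nc_eval_def poly_altdef)

definition right_factor :: "'a::semiring_0 poly \<Rightarrow> 'a poly \<Rightarrow> bool" where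
  "right_factor B Q \<longleftrightarrow> (\<exists>C. Q = C \<star> B)"

text \<open>The library's \<^const>\<open>gcd\<close> of real or complex polynomials is monic.\<close>

lemma lead_coeff_gcd_complex:
  fixes p q :: "complex poly"
  assumes "p \<noteq> 0 \<or> q \<noteq> 0"
  shows "lead_coeff (gcd p q) = 1"
proof -
  have "unit_factor (gcd p q) = 1"
    using assms by (auto simp: unit_factor_gcd)
  then show ?thesis
    by (simp add: unit_factor_poly_def one_pCons)
qed

lemma lead_coeff_gcd_real:
  fixes p q :: "real poly"
  assumes "p \<noteq> 0 \<or> q \<noteq> 0"
  shows "lead_coeff (gcd p q) = 1"
proof -
  have "unit_factor (gcd p q) = 1"
    using assms by (auto simp: unit_factor_gcd)
  then show ?thesis
    by (simp add: unit_factor_poly_def one_pCons)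
qed

text \<open>The inclusion of \<^typ>\<open>complex poly\<close> in \<^typ>\<open>quat poly\<close>; its range is the subring
  of quaternionic polynomials with complex coefficients.\<close>

definition quat_poly :: "complex poly \<Rightarrow> quat poly" where
  "quat_poly p = map_poly quat_of_complex p"

lemma coeff_quat_poly: "coeff (quat_poly p) m = quat_of_complex (coeff p m)"
  by (simp add: quat_poly_def coeff_map_poly)

lemma quat_poly_decomposition:
  "\<exists>!(f, g). (Q :: quat poly) = quat_poly f + [:quat_k:] \<star> quat_poly g"
proof -
  have coeff: "coeff (quat_poly f + [:quat_k:] \<star> quat_poly g) m =
      Quat (Re (coeff f m)) (Im (coeff f m)) (Im (coeff g m)) (Re (coeff g m))" for f g m
  proof -
    have "(\<Sum>i\<le>m. coeff [:quat_k:] i * coeff (quat_poly g) (m - i)) =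
        (\<Sum>i\<le>m. if i = 0 then quat_k * coeff (quat_poly g) m else 0)"
      by (intro sum.cong) (auto simp: coeff_pCons split: nat.split)
    then have "coeff ([:quat_k:] \<star> quat_poly g) m = quat_k * coeff (quat_poly g) m"
      by (simp add: coeff_nc_times)
    then show ?thesis
      by (simp add: coeff_quat_poly quat_of_complex_eq quat_k_def times_quat_def plus_quat_def)
  qed
  define f where "f = map_poly (\<lambda>q. Complex (qRe q) (qI q)) Q"
  define g where "g = map_poly (\<lambda>q. Complex (qK q) (qJ q)) Q"
  have "coeff f m = Complex (qRe (coeff Q m)) (qI (coeff Q m))"
    "coeff g m = Complex (qK (coeff Q m)) (qJ (coeff Q m))" for m
    by (simp_all add: f_def g_def coeff_map_poly zero_quat_def complex_eq_iff)
  then have "Q = quat_poly f + [:quat_k:] \<star> quat_poly g"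
    by (simp add: poly_eq_iff coeff del: coeff_add)
  moreover have "f' = f \<and> g' = g"
    if "Q = quat_poly f' + [:quat_k:] \<star> quat_poly g'" for f' g'
    using that calculation by (simp add: poly_eq_iff coeff complex_eq_iff del: coeff_add)
  ultimately show ?thesis by auto
qed


section \<open>The Bezout matrix\<close>

text \<open>
  Bivariate polynomials are represented as \<^typ>\<open>'a poly poly\<close>, with \<open>x\<close> the outer and \<open>y\<close> the
  inner variable: \<open>P(x)\<close> is \<open>map_poly (\<lambda>c. [:c:]) P\<close>, \<open>P(y)\<close> is \<open>[:P:]\<close>, and \<open>x - y\<close> is
  \<open>[:- [:0, 1:], 1:]\<close>. The division is exact.
\<close>

definition bezout_numerator :: "'a::field_char_0 poly \<Rightarrow> 'a poly \<Rightarrow> 'a poly poly" where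
  "bezout_numerator P R = map_poly (\<lambda>c. [:c:]) P * [:R:] - [:P:] * map_poly (\<lambda>c. [:c:]) R"

definition bezoutian :: "'a::field_char_0 poly \<Rightarrow> 'a poly \<Rightarrow> 'a poly poly" where
  "bezoutian P R = bezout_numerator P R div [:- [:0, 1:], 1:]"

definition Bez :: "'a::field_char_0 poly \<Rightarrow> 'a poly \<Rightarrow> 'a mat" where
  "Bez P R = (let d = max (degree P) (degree R)
     in mat d d (\<lambda>(i, j). coeff (coeff (bezoutian P R) i) j))"

lemma bezoutian_exact: "bezoutian P R * [:- [:0, 1:], 1:] = bezout_numerator P R"
proof -
  have "poly (map_poly (\<lambda>c. [:c:]) p) [:0, 1:] = p" for p :: "'a poly"
    by (induction p) (simp_all add: map_poly_pCons)
  then have "poly (bezout_numerator P R) [:0, 1:] = 0"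
    by (simp add: bezout_numerator_def)
  then have "[:- [:0, 1:], 1:] dvd bezout_numerator P R"
    by (simp only: poly_eq_0_iff_dvd)
  then show ?thesis
    unfolding bezoutian_def by (rule dvd_div_mult_self)
qed

definition mat_rank :: "'a::field mat \<Rightarrow> nat" where
  "mat_rank A = vec_space.rank (dim_row A) A"

end

theory Submission
  imports Defs
begin

text \<open>
  If \<open>C = c + k d\<close> with \<open>c, d\<close> complex, then \<open>C B = c B + k (d B)\<close> for complex \<open>B\<close>, so the complex
  right factors of \<open>f + k g\<close> are the common divisors of \<open>f\<close> and \<open>g\<close>.

  For the rank, column \<open>j\<close> of the Bezout matrix is the coefficient vector of \<open>g f\<^sub>j - f g\<^sub>j\<close>, where
  \<open>p\<^sub>j\<close> is the polynomial part of \<open>p / x^(j + 1)\<close>. The \<open>f\<^sub>j\<close> span the polynomials of degree less than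
  \<open>n = degree f\<close>, and all columns have degree less than \<open>n\<close>. By Bezout's identity, with the cofactor
  of \<open>g\<close> reduced modulo \<open>f / gcd f g\<close>, the column space consists of all multiples of \<open>gcd f g\<close> of
  degree less than \<open>n\<close>.
\<close>

section \<open>The Bezout matrix\<close>

lemma poly_shift_eq_pCons: "poly_shift k P = pCons (coeff P k) (poly_shift (Suc k) P)"
  by (auto simp: poly_eq_iff coeff_poly_shift coeff_pCons split: nat.split)

text \<open>Closed form of \<open>(P(x) - P(y)) / (x - y)\<close>, with \<open>x\<close> outer and
  \<open>y\<close> inner: the coefficient of \<open>x^i y^j\<close> is that of \<open>P\<close> at
  \<open>i + j + 1\<close>.\<close>

definition difference_quotient :: "'a::comm_ring_1 poly \<Rightarrow> 'a poly poly" where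
  "difference_quotient P = (\<Sum>i<degree P. monom (poly_shift (Suc i) P) i)"

lemma coeff_difference_quotient: "coeff (difference_quotient P) i = poly_shift (Suc i) P"
proof (cases "i < degree P")
  case True
  then show ?thesis
    by (simp add: difference_quotient_def coeff_sum sum.delta)
next
  case False
  then have "poly_shift (Suc i) P = 0"
    by (auto simp: poly_eq_iff coeff_poly_shift intro!: coeff_eq_0)
  with False show ?thesis
    by (auto simp: difference_quotient_def coeff_sum intro!: sum.neutral)
qed

lemma difference_quotient_exact:
  "difference_quotient P * [:- [:0, 1:], 1:] = map_poly (\<lambda>c. [:c:]) P - [:P:]"
proof -
  have "coeff (difference_quotient P * [:- [:0, 1:], 1:]) k =
      coeff (map_poly (\<lambda>c. [:c:]) P - [:P:]) k" for k
  proof (cases k)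
    case 0
    have "[:coeff P 0:] - P = - pCons 0 (poly_shift (Suc 0) P)"
      by (subst (2) poly_shift_eq_pCons[of 0 P, simplified]) simp
    with 0 show ?thesis
      by (simp add: coeff_difference_quotient coeff_map_poly)
  next
    case (Suc m)
    then show ?thesis
      using poly_shift_eq_pCons[of k P]
      by (simp add: coeff_difference_quotient coeff_map_poly)
  qed
  then show ?thesis by (simp add: poly_eq_iff)
qed

text \<open>The polynomial in \<open>x\<close> whose coefficients form column \<open>j\<close> of \<open>Bez P R\<close>.\<close>

definition bezout_column :: "'a::comm_ring_1 poly \<Rightarrow> 'a poly \<Rightarrow> nat \<Rightarrow> 'a poly" where
  "bezout_column P R j = R * poly_shift (Suc j) P - P * poly_shift (Suc j) R"

text \<open>The difference quotient is symmetric in \<open>x\<close> and \<open>y\<close>, so its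
  part at \<open>y^j\<close> is again a shift of \<open>P\<close>, now read in \<open>x\<close>; the
  factor \<open>R(x)\<close> does not involve \<open>y\<close>.\<close>

lemma coeff_coeff_map_poly_times_difference_quotient:
  "coeff (coeff (map_poly (\<lambda>c. [:c:]) R * difference_quotient P) i) j =
    coeff (R * poly_shift (Suc j) P) i"
  by (simp add: coeff_mult coeff_sum coeff_map_poly coeff_difference_quotient coeff_poly_shift
      add.commute)

text \<open>Adding and subtracting \<open>P(x) R(x)\<close> turns the numerator into
  \<open>R(x) (P(x) - P(y)) - P(x) (R(x) - R(y))\<close>; then \<open>x - y\<close> cancels.\<close>

lemma coeff_bezoutian: "coeff (coeff (bezoutian P R) i) j = coeff (bezout_column P R j) i"
proof -
  let ?X = "map_poly (\<lambda>c. [:c:])" and ?d = "[:- [:0, 1:], 1:] :: 'a poly poly"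
  have "(?X R * difference_quotient P - ?X P * difference_quotient R) * ?d =
      ?X R * (difference_quotient P * ?d) - ?X P * (difference_quotient R * ?d)"
    by (simp only: left_diff_distrib mult.assoc)
  also have "\<dots> = bezout_numerator P R"
    unfolding difference_quotient_exact bezout_numerator_def
    by (simp add: algebra_simps)
  also have "\<dots> = bezoutian P R * ?d"
    by (rule bezoutian_exact[symmetric])
  finally have "bezoutian P R = ?X R * difference_quotient P - ?X P * difference_quotient R"
    by (metis mult_cancel_right pCons_eq_0_iff one_neq_zero)
  then show ?thesis
    by (simp add: bezout_column_def coeff_coeff_map_poly_times_difference_quotient)
qed

text \<open>Each of the two products may have degree \<open>n\<close> or more. Splitting
  \<open>P\<close> and \<open>R\<close> at exponent \<open>j + 1\<close> makes the high terms
  cancel; what remains has a factor of degree at most \<open>j\<close> and one of degree at most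
  \<open>n - j - 1\<close>.\<close>

lemma coeff_bezout_column_eq_0:
  assumes "degree P \<le> n" "degree R \<le> n" "j < n" "n \<le> i"
  shows "coeff (bezout_column P R j) i = 0"
proof -
  have split: "p = monom 1 (Suc j) * poly_shift (Suc j) p + poly_cutoff (Suc j) p"
    for p :: "'a poly"
    by (simp add: poly_eq_iff coeff_monom_mult coeff_poly_shift coeff_poly_cutoff)
  have "bezout_column P R j = poly_cutoff (Suc j) R * poly_shift (Suc j) P
      - poly_cutoff (Suc j) P * poly_shift (Suc j) R"
  proof -
    have "bezout_column P R j =
        (monom 1 (Suc j) * poly_shift (Suc j) R + poly_cutoff (Suc j) R) * poly_shift (Suc j) P
        - (monom 1 (Suc j) * poly_shift (Suc j) P + poly_cutoff (Suc j) P) * poly_shift (Suc j) R"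
      by (simp only: split[symmetric] bezout_column_def)
    then show ?thesis by (simp add: algebra_simps)
  qed
  moreover have "coeff (poly_cutoff (Suc j) p * poly_shift (Suc j) q) i = 0"
    if "degree q \<le> n" for p q :: "'a poly"
    unfolding coeff_mult
    using assms(3,4) that
    by (intro sum.neutral ballI)
      (auto simp: coeff_poly_cutoff coeff_poly_shift coeff_eq_0)
  ultimately show ?thesis
    using assms(1,2) by simp
qed

text \<open>The shifts of \<open>f\<close> have the degrees \<open>0, \<dots>, degree f - 1\<close>, hence form a basis of the
  polynomials of smaller degree.\<close>

lemma ex_poly_shift_combination:
  fixes f a :: "'a::field poly"
  assumes "\<And>i. degree f \<le> i \<Longrightarrow> coeff a i = 0"
  shows "\<exists>w. a = (\<Sum>j<degree f. Polynomial.smult (w j) (poly_shift (Suc j) f))"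
proof -
  have "\<exists>w. a = (\<Sum>j<degree f. Polynomial.smult (w j) (poly_shift (Suc j) f))"
    if "N \<le> degree f" "\<And>i. N \<le> i \<Longrightarrow> coeff a i = 0" for N
    using that
  proof (induction N arbitrary: a)
    case 0
    then have "a = 0" by (simp add: poly_eq_iff)
    then show ?case by (intro exI[of _ "\<lambda>_. 0"]) simp
  next
    case (Suc N)
    \<comment> \<open>The shift by \<open>Suc k\<close> has degree exactly \<open>N\<close> and the
      leading coefficient of \<open>f\<close>, so subtracting \<open>c\<close> times it removes the
      coefficient of \<open>a\<close> at \<open>N\<close>.\<close>
    define k where "k = degree f - Suc N"
    have k: "k < degree f" "N + Suc k = degree f"
      using Suc.prems(1) by (auto simp: k_def)
    define c where "c = coeff a N / lead_coeff f"
    define b where "b = a - Polynomial.smult c (poly_shift (Suc k) f)"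
    have "f \<noteq> 0" using k by auto
    have "coeff b i = 0" if "N \<le> i" for i
    proof (cases "i = N")
      case True
      then show ?thesis
        using \<open>f \<noteq> 0\<close> k by (simp add: b_def c_def coeff_poly_shift)
    next
      case False
      with that have "Suc N \<le> i" by simp
      moreover have "coeff f (i + Suc k) = 0"
        using \<open>Suc N \<le> i\<close> k by (intro coeff_eq_0) simp
      ultimately show ?thesis
        using Suc.prems(2) by (simp add: b_def coeff_poly_shift)
    qed
    with Suc.IH[of b] Suc.prems(1) obtain w
      where w: "b = (\<Sum>j<degree f. Polynomial.smult (w j) (poly_shift (Suc j) f))"
      by auto
    have "a = b + Polynomial.smult c (poly_shift (Suc k) f)"
      by (simp add: b_def)
    also have "Polynomial.smult c (poly_shift (Suc k) f) =
        (\<Sum>j<degree f. Polynomial.smult (if j = k then c else 0) (poly_shift (Suc j) f))"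
      using k(1) by (simp add: if_distrib[of "\<lambda>c. Polynomial.smult c _"] sum.delta cong: if_cong)
    also have "b + \<dots> =
        (\<Sum>j<degree f. Polynomial.smult (w j + (if j = k then c else 0)) (poly_shift (Suc j) f))"
      by (simp only: w sum.distrib[symmetric] smult_add_left)
    finally show ?case by (intro exI[of _ "\<lambda>j. w j + (if j = k then c else 0)"])
  qed
  from this[of "degree f"] assms show ?thesis by simp
qed

section \<open>The span of the columns as a space of multiples of the gcd\<close>

lemma bezout_column_combinations:
  fixes f g :: "'a::field_gcd poly"
  assumes "f \<noteq> 0" "degree g \<le> degree f"
  shows "range (\<lambda>w. \<Sum>j<degree f. Polynomial.smult (w j) (bezout_column f g j)) =
    range (\<lambda>v. \<Sum>j<degree f - degree (gcd f g). Polynomial.smult (v j) (gcd f g * monom 1 j))"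
    (is "?L = ?R")
proof -
  let ?n = "degree f" and ?E = "gcd f g"
  let ?m = "?n - degree ?E"
  have E0: "?E \<noteq> 0" using assms by simp
  obtain u v where u: "f = ?E * u" and v: "g = ?E * v"
    by (meson dvdE gcd_dvd1 gcd_dvd2)
  have u0: "u \<noteq> 0" using u assms(1) by auto
  have n: "?n = degree ?E + degree u"
    using u E0 u0 by (metis degree_mult_eq)
  have high: "coeff (\<Sum>j<?n. Polynomial.smult (w j) (bezout_column f g j)) i = 0" if "?n \<le> i" for w i
    using coeff_bezout_column_eq_0[of f ?n g _ i] assms(2) that
    by (auto simp: coeff_sum intro!: sum.neutral)
  have sum_column: "(\<Sum>j<?n. Polynomial.smult (w j) (bezout_column f g j)) =
      g * (\<Sum>j<?n. Polynomial.smult (w j) (poly_shift (Suc j) f))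
      - f * (\<Sum>j<?n. Polynomial.smult (w j) (poly_shift (Suc j) g))" for w
    by (simp add: bezout_column_def smult_diff_right sum_subtractf sum_distrib_left)
  \<comment> \<open>The degree bound on \<open>q\<close> bounds the cofactor \<open>p\<close> by
    \<open>?m\<close>, and the coefficients of \<open>p\<close> serve as weights.\<close>
  have R: "q \<in> ?R" if "q = ?E * p" "\<And>i. ?n \<le> i \<Longrightarrow> coeff q i = 0" for p q
  proof -
    have "coeff p j = 0" if "?m \<le> j" for j
    proof (cases "p = 0")
      case False
      have "degree q < ?n \<or> q = 0"
        using that(1) \<open>\<And>i. ?n \<le> i \<Longrightarrow> coeff q i = 0\<close>
        by (metis leading_coeff_0_iff linorder_not_le)
      then have "degree p < ?m"
        using False E0 \<open>q = ?E * p\<close> by (auto simp: degree_mult_eq)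
      then show ?thesis using that by (intro coeff_eq_0) simp
    qed simp
    then have "p = (\<Sum>j<?m. Polynomial.smult (coeff p j) (monom 1 j))"
      by (auto simp: poly_eq_iff coeff_sum smult_monom sum.delta not_less)
    then have "q = (\<Sum>j<?m. Polynomial.smult (coeff p j) (?E * monom 1 j))"
      unfolding \<open>q = ?E * p\<close>
      by (metis (no_types, lifting) mult_smult_right sum.cong sum_distrib_left)
    then show ?thesis by blast
  qed
  have "?L \<subseteq> ?R"
  proof
    fix q assume "q \<in> ?L"
    then obtain w where w: "q = (\<Sum>j<?n. Polynomial.smult (w j) (bezout_column f g j))" by auto
    have "?E dvd q"
      unfolding w sum_column by (intro dvd_diff dvd_mult2) simp_all
    then obtain p where "q = ?E * p" by (elim dvdE)
    then show "q \<in> ?R" by (rule R) (simp add: w high)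
  qed
  moreover have "?R \<subseteq> ?L"
  proof
    fix q assume "q \<in> ?R"
    then obtain c where c: "q = (\<Sum>j<?m. Polynomial.smult (c j) (?E * monom 1 j))" by auto
    define p where "p = (\<Sum>j<?m. monom (c j) j)"
    have qp: "q = ?E * p"
      by (simp add: c p_def sum_distrib_left smult_monom flip: mult_smult_right)
    have "degree q < ?n" if "q \<noteq> 0"
    proof -
      have "p \<noteq> 0" using that qp by auto
      have "\<forall>i\<ge>?m. coeff p i = 0"
        by (auto simp: p_def coeff_sum intro!: sum.neutral)
      then have "degree p < ?m"
        using \<open>p \<noteq> 0\<close> by (metis leading_coeff_0_iff linorder_not_le)
      then show ?thesis
        using qp E0 \<open>p \<noteq> 0\<close> by (simp add: degree_mult_eq)
    qed
    obtain a b where ab: "a * f + b * g = ?E"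
      using bezout_coefficients_fst_snd by blast
    \<comment> \<open>Since \<open>g * u = f * v\<close>, changing \<open>b * p\<close> by a
      multiple of \<open>u\<close> changes \<open>g * (b * p)\<close> by a multiple of
      \<open>f\<close> only. The remainder is small enough to be a combination of the shifts of
      \<open>f\<close>.\<close>
    define r where "r = (b * p) mod u"
    have "degree r < degree u \<or> r = 0"
      unfolding r_def using u0 by (metis degree_mod_less)
    then have "coeff r i = 0" if "?n \<le> i" for i
      using that n by (auto intro: coeff_eq_0)
    then obtain w where w: "r = (\<Sum>j<?n. Polynomial.smult (w j) (poly_shift (Suc j) f))"
      using ex_poly_shift_combination by blast
    let ?s = "\<Sum>j<?n. Polynomial.smult (w j) (bezout_column f g j)"
    \<comment> \<open>Modulo \<open>f\<close>, both \<open>q\<close> and \<open>?s\<close> are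
      congruent to \<open>g * r\<close>. As both have only coefficients below \<open>?n\<close>,
      they then coincide.\<close>
    have "f dvd q - ?s"
    proof -
      have "b * p = u * (b * p div u) + r"
        by (simp add: r_def)
      then have "g * (b * p) = g * u * (b * p div u) + g * r"
        by (metis distrib_left mult.assoc)
      also have "g * u = f * v"
        by (metis u v mult.assoc mult.commute)
      finally have "g * (b * p) = f * v * (b * p div u) + g * r" .
      moreover have "q = a * p * f + g * (b * p)"
        unfolding qp ab[symmetric] by (simp add: algebra_simps)
      ultimately have "q = a * p * f + f * v * (b * p div u) + g * r"
        by (simp only: add.assoc)
      then show ?thesis
        unfolding sum_column w[symmetric] by (auto intro!: dvd_add dvd_diff)
    qed
    moreover have "degree (q - ?s) < ?n" if "q - ?s \<noteq> 0"
    proof -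
      have "coeff (q - ?s) i = 0" if "?n \<le> i" for i
        using high[OF that] \<open>q \<noteq> 0 \<Longrightarrow> degree q < ?n\<close> that
        by (cases "q = 0") (auto simp: coeff_eq_0)
      then show ?thesis
        using that by (metis leading_coeff_0_iff linorder_not_le)
    qed
    ultimately have "q = ?s"
      by (metis dvd_imp_degree_le eq_iff_diff_eq_0 linorder_not_le)
    then show "q \<in> ?L" by blast
  qed
  ultimately show ?thesis by blast
qed

section \<open>Ranks of matrices whose columns are coefficient vectors\<close>

definition coeff_mat :: "nat \<Rightarrow> nat \<Rightarrow> (nat \<Rightarrow> 'a::comm_ring_1 poly) \<Rightarrow> 'a mat" where
  "coeff_mat n k c = mat n k (\<lambda>(i, j). coeff (c j) i)"

lemma coeff_mat_carrier: "coeff_mat n k c \<in> carrier_mat n k"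
  by (simp add: coeff_mat_def)

lemma coeff_mat_mult_vec:
  assumes "w \<in> carrier_vec k"
  shows "coeff_mat n k c *\<^sub>v w = vec n (coeff (\<Sum>j<k. Polynomial.smult (w $ j) (c j)))"
  using assms
  by (intro eq_vecI)
    (auto simp: coeff_mat_def scalar_prod_def coeff_sum atLeast0LessThan mult.commute)

lemma col_space_coeff_mat:
  fixes c :: "nat \<Rightarrow> 'a::field poly"
  shows "vec_space.col_space n (coeff_mat n k c) =
    (\<lambda>p. vec n (coeff p)) ` range (\<lambda>w. \<Sum>j<k. Polynomial.smult (w j) (c j))" (is "_ = ?R")
proof -
  interpret vec_space "TYPE('a)" n .
  have "col_space (coeff_mat n k c) = (\<lambda>w. coeff_mat n k c *\<^sub>v w) ` carrier_vec k"
    using mult_mat_vec_carrier[OF coeff_mat_carrier]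
    unfolding col_space_eq[OF coeff_mat_carrier] by (auto simp: coeff_mat_def)
  also have "\<dots> = (\<lambda>w. vec n (coeff (\<Sum>j<k. Polynomial.smult (w $ j) (c j)))) ` carrier_vec k"
    by (intro image_cong) (simp_all add: coeff_mat_mult_vec)
  also have "\<dots> = ?R"
  proof -
    have "(\<Sum>j<k. Polynomial.smult (w j) (c j)) = (\<Sum>j<k. Polynomial.smult (vec k w $ j) (c j))"
      for w by (intro sum.cong) simp_all
    then have "vec n (coeff (\<Sum>j<k. Polynomial.smult (w j) (c j))) \<in>
        (\<lambda>w. vec n (coeff (\<Sum>j<k. Polynomial.smult (w $ j) (c j)))) ` carrier_vec k" for w
      by (intro image_eqI[of _ _ "vec k w"]) (simp_all only: vec_carrier)
    then show ?thesis by auto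
  qed
  finally show ?thesis .
qed

text \<open>The rank depends only on the column space. The families may differ in length, which
  allows the Bezout columns to be replaced by a shorter independent family.\<close>

lemma mat_rank_coeff_mat_cong:
  fixes c c' :: "nat \<Rightarrow> 'a::field poly"
  assumes "range (\<lambda>w. \<Sum>j<k. Polynomial.smult (w j) (c j)) = range (\<lambda>w. \<Sum>j<k'. Polynomial.smult (w j) (c' j))"
  shows "mat_rank (coeff_mat n k c) = mat_rank (coeff_mat n k' c')"
proof -
  interpret vec_space "TYPE('a)" n .
  have "col_space (coeff_mat n k c) = col_space (coeff_mat n k' c')"
    unfolding col_space_coeff_mat assms ..
  moreover have "dim_row (coeff_mat n k c) = n" "dim_row (coeff_mat n k' c') = n"
    by (simp_all add: coeff_mat_def)
  ultimately show ?thesis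
    by (simp add: mat_rank_def rank_def col_space_def)
qed

text \<open>By the degree bound no coefficient of \<open>e * p\<close> with
  \<open>degree p < k\<close> is cut off, so a kernel vector yields \<open>e * p = 0\<close> and
  hence \<open>p = 0\<close>.\<close>

lemma mat_rank_coeff_mat_multiples:
  fixes e :: "'a::field poly"
  assumes "e \<noteq> 0" "degree e + k \<le> n"
  shows "mat_rank (coeff_mat n k (\<lambda>j. e * monom 1 j)) = k"
proof -
  interpret vec_space "TYPE('a)" n .
  let ?M = "coeff_mat n k (\<lambda>j. e * monom 1 j)"
  have inj: "w = 0\<^sub>v k" if w: "w \<in> carrier_vec k" "?M *\<^sub>v w = 0\<^sub>v n" for w
  proof -
    define p where "p = (\<Sum>j<k. monom (w $ j) j)"
    have coeff_p: "coeff p i = (if i < k then w $ i else 0)" for i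
      by (simp add: p_def coeff_sum sum.delta)
    have "(\<Sum>j<k. Polynomial.smult (w $ j) (e * monom 1 j)) = e * p"
      by (simp add: p_def sum_distrib_left smult_monom flip: mult_smult_right)
    then have "?M *\<^sub>v w = vec n (coeff (e * p))"
      by (simp only: coeff_mat_mult_vec[OF w(1)])
    with w(2) have low: "coeff (e * p) i = 0" if "i < n" for i
      using index_vec[OF that, of "coeff (e * p)"] that by simp
    have "p = 0"
    proof (rule ccontr)
      assume "p \<noteq> 0"
      then have "degree p < k"
        using coeff_p by (metis leading_coeff_0_iff)
      then have "degree (e * p) < n"
        using assms \<open>p \<noteq> 0\<close> by (simp add: degree_mult_eq)
      then have "e * p = 0"
        using low by (metis leading_coeff_0_iff)
      then show False using assms(1) \<open>p \<noteq> 0\<close> by simp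
    qed
    then have "w $ i = 0" if "i < k" for i
      using coeff_p[of i] that by simp
    then show ?thesis
      using w(1) by (intro eq_vecI) auto
  qed
  \<comment> \<open>Linear independence concerns the set of columns, so repetitions must be
    excluded: equal columns \<open>i\<close> and \<open>j\<close> would put the difference of two
    unit vectors in the kernel.\<close>
  have "distinct (cols ?M)"
  proof (rule ccontr)
    assume "\<not> distinct (cols ?M)"
    then obtain i j where ij: "i < k" "j < k" "i \<noteq> j" "col ?M i = col ?M j"
      by (auto simp: distinct_conv_nth coeff_mat_def)
    have "?M *\<^sub>v unit_vec k l = col ?M l" if "l < k" for l
      using that by (intro eq_vecI) (auto simp: coeff_mat_def scalar_prod_right_unit)
    then have "?M *\<^sub>v (unit_vec k i - unit_vec k j) = col ?M i - col ?M j"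
      using ij by (subst mult_minus_distrib_mat_vec[OF coeff_mat_carrier]) simp_all
    also have "\<dots> = 0\<^sub>v n"
      unfolding ij(4) by (intro eq_vecI) (auto simp: coeff_mat_def)
    finally have "?M *\<^sub>v (unit_vec k i - unit_vec k j) = 0\<^sub>v n" .
    then have "unit_vec k i - unit_vec k j = (0\<^sub>v k :: 'a vec)"
      by (intro inj) auto
    then have "(unit_vec k i - unit_vec k j) $ i = (0::'a)"
      using ij by simp
    with ij show False by simp
  qed
  moreover have "\<not> lin_dep (set (cols ?M))"
  proof
    assume "lin_dep (set (cols ?M))"
    from lin_depE[OF coeff_mat_carrier this \<open>distinct (cols ?M)\<close>] inj show False by metis
  qed
  ultimately have "rank ?M = k"
    using lin_indpt_full_rank[OF coeff_mat_carrier] by blast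
  then show ?thesis by (simp add: mat_rank_def coeff_mat_def)
qed

lemma mat_rank_Bez:
  fixes f g :: "'a::{field_char_0, field_gcd} poly"
  assumes "f \<noteq> 0" "degree g \<le> degree f"
  shows "mat_rank (Bez f g) = degree f - degree (gcd f g)"
proof -
  have "Bez f g = coeff_mat (degree f) (degree f) (bezout_column f g)"
    using assms(2) by (simp add: Bez_def coeff_mat_def coeff_bezoutian Let_def)
  moreover have "degree (gcd f g) \<le> degree f"
    using assms(1) by (intro dvd_imp_degree_le) auto
  ultimately show ?thesis
    using mat_rank_coeff_mat_cong[OF bezout_column_combinations[OF assms]]
      mat_rank_coeff_mat_multiples[of "gcd f g"] assms(1)
    by simp
qed

section \<open>Complex right factors\<close>

lemma quat_of_complex_sum: "quat_of_complex (sum h A) = (\<Sum>x\<in>A. quat_of_complex (h x))"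
  by (induction A rule: infinite_finite_induct) simp_all

lemma coeff_const_nc_times: "coeff ([:a:] \<star> P) m = a * coeff P m"
proof -
  have "(\<Sum>i\<le>m. coeff [:a:] i * coeff P (m - i)) = (\<Sum>i\<le>m. if i = 0 then a * coeff P m else 0)"
    by (intro sum.cong) (auto simp: coeff_pCons split: nat.split)
  then show ?thesis by (simp add: coeff_nc_times)
qed

text \<open>Because \<open>k (x + y i) = y j + x k\<close>, the imaginary part of \<open>g\<close>
  sits at \<open>j\<close> and the real part at \<open>k\<close>.\<close>

lemma coeff_quat_decomposition:
  "coeff (quat_poly f + [:quat_k:] \<star> quat_poly g) m =
    Quat (Re (coeff f m)) (Im (coeff f m)) (Im (coeff g m)) (Re (coeff g m))"
  by (simp add: coeff_const_nc_times coeff_quat_poly quat_of_complex_eq quat_k_def times_quat_def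
      plus_quat_def)

lemma quat_decomposition_eq_iff:
  "quat_poly f + [:quat_k:] \<star> quat_poly g = quat_poly f' + [:quat_k:] \<star> quat_poly g' \<longleftrightarrow>
    f = f' \<and> g = g'"
  by (auto simp: poly_eq_iff coeff_quat_decomposition complex_eq_iff simp del: coeff_add)

text \<open>As \<open>k\<close> stands on the left, associativity and distributivity suffice;
  \<open>k\<close> is never moved past a complex coefficient.\<close>

lemma quat_decomposition_times:
  "(quat_poly c + [:quat_k:] \<star> quat_poly d) \<star> quat_poly b =
    quat_poly (c * b) + [:quat_k:] \<star> quat_poly (d * b)"
  by (simp add: poly_eq_iff coeff_nc_times[of _ "quat_poly b"] coeff_const_nc_times
      coeff_quat_poly coeff_mult quat_of_complex_sum sum.distrib sum_distrib_left
      distrib_right mult.assoc)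

lemma degree_quat_poly: "degree (quat_poly p) = degree p"
proof -
  have "quat_of_complex z = 0 \<longleftrightarrow> z = 0" for z
    by (simp add: quat_of_complex_eq zero_quat_def complex_eq_iff)
  then show ?thesis
    by (simp add: quat_poly_def degree_map_poly)
qed

lemma coeff_quat_poly_eq_1_iff: "coeff (quat_poly p) m = 1 \<longleftrightarrow> coeff p m = 1"
  using inj_eq[OF inj_quat_of_complex, of "coeff p m" 1]
  by (simp add: coeff_quat_poly)

text \<open>Uniqueness of the decomposition separates the factorization of \<open>Q\<close> into one
  of \<open>f\<close> and one of \<open>g\<close>, with independent cofactors.\<close>

lemma right_factor_quat_poly_iff:
  assumes "Q = quat_poly f + [:quat_k:] \<star> quat_poly g"
  shows "right_factor (quat_poly b) Q \<longleftrightarrow> b dvd gcd f g"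
proof
  assume "right_factor (quat_poly b) Q"
  then obtain C where "Q = C \<star> quat_poly b" by (auto simp: right_factor_def)
  moreover obtain c d where "C = quat_poly c + [:quat_k:] \<star> quat_poly d"
    using quat_poly_decomposition[of C] by auto
  ultimately have "Q = quat_poly (c * b) + [:quat_k:] \<star> quat_poly (d * b)"
    by (simp add: quat_decomposition_times)
  with assms have "f = c * b" "g = d * b"
    by (simp_all add: quat_decomposition_eq_iff)
  then show "b dvd gcd f g" by simp
next
  assume "b dvd gcd f g"
  then obtain c d where "f = c * b" "g = d * b"
    by (metis dvd_trans gcd_dvd1 gcd_dvd2 dvdE mult.commute)
  then have "Q = (quat_poly c + [:quat_k:] \<star> quat_poly d) \<star> quat_poly b"
    using assms by (simp add: quat_decomposition_times)
  then show "right_factor (quat_poly b) Q" by (auto simp: right_factor_def)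
qed

section \<open>Real roots\<close>

lemma nc_eval_of_real_eq_0_iff:
  assumes "\<And>m. coeff Q m = Quat (coeff a m) (coeff b m) (coeff c m) (coeff d m)"
  shows "nc_eval Q (of_real z) = 0 \<longleftrightarrow> poly a z = 0 \<and> poly b z = 0 \<and> poly c z = 0 \<and> poly d z = 0"
proof -
  have parts: "qRe (sum h A) = (\<Sum>x\<in>A. qRe (h x))" "qI (sum h A) = (\<Sum>x\<in>A. qI (h x))"
    "qJ (sum h A) = (\<Sum>x\<in>A. qJ (h x))" "qK (sum h A) = (\<Sum>x\<in>A. qK (h x))"
    for h :: "nat \<Rightarrow> quat" and A
    by (induction A rule: infinite_finite_induct) (simp_all add: zero_quat_def plus_quat_def)
  \<comment> \<open>The components may have smaller degree than \<open>Q\<close>; their evaluations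
    are padded with zero terms to a common range.\<close>
  have low: "degree p \<le> degree Q" if "\<And>m. coeff Q m = 0 \<Longrightarrow> coeff p m = 0" for p :: "real poly"
    using that by (intro degree_le) (simp add: coeff_eq_0)
  have deg: "degree a \<le> degree Q" "degree b \<le> degree Q" "degree c \<le> degree Q"
      "degree d \<le> degree Q"
    by (intro low; simp add: assms zero_quat_def)+
  have eval: "poly p z = (\<Sum>i\<le>degree Q. coeff p i * z ^ i)" if "degree p \<le> degree Q"
    for p :: "real poly"
    unfolding poly_altdef using that
    by (intro sum.mono_neutral_left) (auto simp: coeff_eq_0)
  \<comment> \<open>Powers of a real number are real, so evaluation splits into four real
    evaluations.\<close>
  have "of_real z ^ i = Quat (z ^ i) 0 0 0" for i
    by (metis of_real_power of_real_quat)
  then show ?thesis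
    unfolding nc_eval_def quat_eq_iff
    by (simp add: parts assms times_quat_def zero_quat_def eval[OF deg(1)] eval[OF deg(2)]
        eval[OF deg(3)] eval[OF deg(4)])
qed

theorem theorem1:
  fixes Q :: "quat poly" and n :: nat
    and f g E :: "complex poly" and f1 f2 g1 g2 D :: "real poly"
  assumes "degree Q = n" and "n \<ge> 1" and "lead_coeff Q = 1"
    and "Q \<notin> range quat_poly"
    and "Q = quat_poly f + [:quat_k:] \<star> quat_poly g"
    and "f = map_poly of_real f1 + map_poly of_real f2 * [:\<i>:]"
    and "g = map_poly of_real g1 + map_poly of_real g2 * [:\<i>:]"
    and "E = gcd f g"
    and "D = gcd f1 (gcd f2 (gcd g1 g2))"
  shows "{B \<in> range quat_poly. lead_coeff B = 1 \<and> right_factor B Q \<and>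
            (\<forall>B' \<in> range quat_poly. right_factor B' Q \<longrightarrow> degree B' \<le> degree B)} = {quat_poly E}
       \<and> int (degree E) = int n - int (mat_rank (Bez f g))
       \<and> (\<forall>z::real. nc_eval Q (of_real z) = 0 \<longleftrightarrow> poly D z = 0)"
proof -
  have coeff_Q: "coeff Q m = Quat (Re (coeff f m)) (Im (coeff f m)) (Im (coeff g m)) (Re (coeff g m))"
    for m
    using assms(5) coeff_quat_decomposition by simp
  \<comment> \<open>The leading coefficient 1 has components 1, 0, 0, 0, so \<open>f\<close>
    inherits the degree and the leading coefficient of \<open>Q\<close>.\<close>
  have "coeff f n = 1"
    using assms(1,3) coeff_Q[of n] by (simp_all add: one_quat_def complex_eq_iff)
  have "coeff f m = 0 \<and> coeff g m = 0" if "n < m" for m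
    using that assms(1) coeff_Q[of m] by (simp add: coeff_eq_0 zero_quat_def complex_eq_iff)
  then have "degree f \<le> n" "degree g \<le> n"
    by (auto intro: degree_le)
  moreover have "n \<le> degree f"
    using \<open>coeff f n = 1\<close> by (intro le_degree) simp
  ultimately have deg: "degree f = n" "degree g \<le> degree f"
    by simp_all
  have "f \<noteq> 0" using \<open>coeff f n = 1\<close> by auto
  then have E: "E \<noteq> 0" "lead_coeff E = 1" "degree E \<le> n"
    using lead_coeff_gcd_complex[of f g] deg assms(8) by (auto intro: dvd_imp_degree_le)
  have factor: "right_factor (quat_poly b) Q \<longleftrightarrow> b dvd E" for b
    using right_factor_quat_poly_iff[OF assms(5)] assms(8) by simp
  \<comment> \<open>\<open>E\<close> itself competes, so a right factor of highest degree satisfies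
    \<open>degree E \<le> degree b\<close>; its cofactor in \<open>E\<close> is then a constant,
    equal to 1 by comparing leading coefficients.\<close>
  have eqE: "b = E" if "b dvd E" "degree E \<le> degree b" "lead_coeff b = 1" for b
  proof -
    from \<open>b dvd E\<close> obtain c where c: "E = b * c" by (elim dvdE)
    with E(1) have "b \<noteq> 0" "c \<noteq> 0" by auto
    then have "degree c = 0" using c that(2) by (simp add: degree_mult_eq)
    moreover have "lead_coeff c = 1" using c E(2) that(3) by (simp add: lead_coeff_mult)
    ultimately have "c = 1" by (auto elim!: degree_eq_zeroE)
    with c show ?thesis by simp
  qed
  have "{B \<in> range quat_poly. lead_coeff B = 1 \<and> right_factor B Q \<and>
      (\<forall>B' \<in> range quat_poly. right_factor B' Q \<longrightarrow> degree B' \<le> degree B)} = {quat_poly E}"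
    using E eqE
    by (auto simp: factor coeff_quat_poly_eq_1_iff degree_quat_poly
        intro: dvd_imp_degree_le arg_cong[of _ _ quat_poly])
  \<comment> \<open>The bound \<open>degree E \<le> n\<close> makes the truncated subtraction in the
    rank formula exact.\<close>
  moreover have "int (degree E) = int n - int (mat_rank (Bez f g))"
    using mat_rank_Bez[OF \<open>f \<noteq> 0\<close> deg(2)] deg(1) E(3) assms(8) by simp
  moreover have "nc_eval Q (of_real z) = 0 \<longleftrightarrow> poly D z = 0" for z
  proof -
    have "coeff Q m = Quat (coeff f1 m) (coeff f2 m) (coeff g2 m) (coeff g1 m)" for m
      by (simp add: coeff_Q assms(6,7) coeff_map_poly)
    from nc_eval_of_real_eq_0_iff[OF this] show ?thesis
      \<comment> \<open>A linear factor divides the gcd iff it divides all four components.\<close>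
      by (auto simp: poly_eq_0_iff_dvd assms(9))
  qed
  ultimately show ?thesis by blast
qed

end
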